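(* Let $X$ be a mixed unicyclic graph whose (unique) cycle has order $n$. Then $X$ is switching equivalent to a mixed unicyclic graph $Y$ with $G(Y)=G(X)$ such that one of the following holds: (i) all edges of $Y$ are undirected; (ii) the cycle of $Y$ is $C_n^{1}$ and all other edges of $Y$ are undirected; (iii) the cycle of $Y$ is $C_n^{2}$ and all other edges of $Y$ are undirected.
   Context: A mixed graph $X$ has undirected edges and directed edges (ordered pairs $(x,y)$); $G(X)$ is its underlying simple graph. $X$ is unicyclic if $G(X)$ is connected and has exactly one cycle. For vertices $v_1,\dots,v_n$, the Hermitian adjacency matrix $H(X)$ has $(j,k)$ entry $1$ if $v_jv_k$ is an undirected edge, $i$ if $(v_j,v_k)$ is a directed edge, $-i$ if $(v_k,v_j)$ is a directed edge, $0$ otherwise. $X,Y$ on the same vertex set are switching equivalent if $H(X)=D^{-1}H(Y)D$ for a diagonal $D$ with diagonal entries in $\{\pm1,\pm i\}$. $C_n^1$ is the mixed cycle of order $n$ with exactly one directed edge, all others undirected; $C_n^2$ is the mixed cycle of order $n$ with two consecutive directed edges $(u,v),(v,w)$ with the same direction and all other edges undirected. *)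

theory Defs
  imports "HOL-Analysis.Analysis"
begin

text \<open>The vertex set of a mixed graph is the whole (finite) type \<open>'v\<close>. Undirected edges are
  two-element sets, directed edges are ordered pairs.\<close>

record 'v mixed_graph =
  undirected :: "'v set set"
  directed :: "('v \<times> 'v) set"

text \<open>No loops, and any two vertices are joined by at most one edge, directed or not.\<close>

definition mixed_graph :: "'v mixed_graph \<Rightarrow> bool" where
  "mixed_graph X \<longleftrightarrow>
     (\<forall>e\<in>undirected X. card e = 2) \<and>
     (\<forall>x y. (x, y) \<in> directed X \<longrightarrow>
        x \<noteq> y \<and> (y, x) \<notin> directed X \<and> {x, y} \<notin> undirected X)"

definition underlying :: "'v mixed_graph \<Rightarrow> 'v set set" where
  "underlying X = undirected X \<union> {{x, y} | x y. (x, y) \<in> directed X}"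

definition graph_connected :: "'v set set \<Rightarrow> bool" where
  "graph_connected E \<longleftrightarrow> (\<forall>u v. (u, v) \<in> {(x, y). {x, y} \<in> E}\<^sup>*)"

text \<open>A cycle (as a graph, with no distinguished start or orientation) has no isolated vertices, so
  it is identified with its edge set.\<close>

definition cycle_graph :: "nat \<Rightarrow> 'v set set \<Rightarrow> bool" where
  "cycle_graph n C \<longleftrightarrow> n \<ge> 3 \<and>
     (\<exists>vs. distinct vs \<and> length vs = n \<and> C = {{vs ! k, vs ! (Suc k mod n)} | k. k < n})"

definition cycle_in :: "'v set set \<Rightarrow> 'v set set \<Rightarrow> bool" where
  "cycle_in E C \<longleftrightarrow> C \<subseteq> E \<and> (\<exists>n. cycle_graph n C)"

definition unicyclic :: "'v mixed_graph \<Rightarrow> bool" where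
  "unicyclic X \<longleftrightarrow> mixed_graph X \<and> graph_connected (underlying X) \<and>
     (\<exists>!C. cycle_in (underlying X) C)"

definition cycle_edges :: "'v mixed_graph \<Rightarrow> 'v set set" where
  "cycle_edges X = (THE C. cycle_in (underlying X) C)"

text \<open>The unique cycle of a unicyclic mixed graph, as a mixed graph. The vertices of \<open>'v\<close> that are
  not on the cycle are to be disregarded in it.\<close>

definition cycle_of :: "'v mixed_graph \<Rightarrow> 'v mixed_graph" where
  "cycle_of X = \<lparr>undirected = undirected X \<inter> cycle_edges X,
                 directed = {(x, y) \<in> directed X. {x, y} \<in> cycle_edges X}\<rparr>"

definition mixed_cycle :: "nat \<Rightarrow> 'v mixed_graph \<Rightarrow> bool" where
  "mixed_cycle n Z \<longleftrightarrow> mixed_graph Z \<and> cycle_graph n (underlying Z)"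

text \<open>Being a copy of \<open>C\<^sub>n\<^sup>1\<close>, respectively of \<open>C\<^sub>n\<^sup>2\<close>.\<close>

definition is_C1 :: "nat \<Rightarrow> 'v mixed_graph \<Rightarrow> bool" where
  "is_C1 n Z \<longleftrightarrow> mixed_cycle n Z \<and> (\<exists>u v. directed Z = {(u, v)})"

definition is_C2 :: "nat \<Rightarrow> 'v mixed_graph \<Rightarrow> bool" where
  "is_C2 n Z \<longleftrightarrow> mixed_cycle n Z \<and>
     (\<exists>u v w. distinct [u, v, w] \<and> directed Z = {(u, v), (v, w)})"

definition hermitian_adj :: "'v::finite mixed_graph \<Rightarrow> complex ^ 'v ^ 'v" where
  "hermitian_adj X = (\<chi> j k.
     if {j, k} \<in> undirected X then 1
     else if (j, k) \<in> directed X then \<i>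
     else if (k, j) \<in> directed X then - \<i>
     else 0)"

definition switching_equivalent :: "'v::finite mixed_graph \<Rightarrow> 'v mixed_graph \<Rightarrow> bool" where
  "switching_equivalent X Y \<longleftrightarrow>
     (\<exists>D :: complex ^ 'v ^ 'v.
        (\<forall>j k. j \<noteq> k \<longrightarrow> D $ j $ k = 0) \<and>
        (\<forall>j. D $ j $ j \<in> {1, - 1, \<i>, - \<i>}) \<and>
        hermitian_adj X = matrix_inv D ** hermitian_adj Y ** D)"

end

theory Submission
  imports Defs
begin

text \<open>Read \<open>H(j, k)\<close> as a gain of the step from \<open>j\<close> to \<open>k\<close>. On a forest every gain is a potential
  difference: adding one edge joins two components, and the potential can be rescaled on one of
  them. Delete from the graph two consecutive edges \<open>pq\<close> and \<open>qr\<close> of the cycle. What is left is a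
  forest in which the component of \<open>q\<close> contains neither \<open>p\<close> nor \<open>r\<close>, so a potential of this forest
  switches all of its edges to undirected ones, and rescaling it on the component of \<open>q\<close>
  distributes the total gain of the cycle at will over the steps \<open>pq\<close> and \<open>qr\<close>: as \<open>1 \<cdot> 1\<close>,
  \<open>1 \<cdot> (\<plusminus>\<i>)\<close> or \<open>\<i> \<cdot> \<i>\<close>.\<close>

section \<open>The fourth roots of unity\<close>

definition quarter_turns :: "complex set" where
  "quarter_turns = {1, - 1, \<i>, - \<i>}"

lemma quarter_turns_one [simp]: "1 \<in> quarter_turns"
  and quarter_turns_i [simp]: "\<i> \<in> quarter_turns"
  and quarter_turns_minus_i [simp]: "- \<i> \<in> quarter_turns"
  by (auto simp: quarter_turns_def)

lemma quarter_turns_mult: "a \<in> quarter_turns \<Longrightarrow> b \<in> quarter_turns \<Longrightarrow> a * b \<in> quarter_turns"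
  by (auto simp: quarter_turns_def)

lemma quarter_turns_divide: "a \<in> quarter_turns \<Longrightarrow> b \<in> quarter_turns \<Longrightarrow> a / b \<in> quarter_turns"
  by (auto simp: quarter_turns_def)

lemma quarter_turns_nonzero: "a \<in> quarter_turns \<Longrightarrow> a \<noteq> 0"
  by (auto simp: quarter_turns_def)

section \<open>Paths, cycles and potentials of forests\<close>

abbreviation adjacency :: "'v set set \<Rightarrow> ('v \<times> 'v) set" where
  "adjacency E \<equiv> {(x, y). {x, y} \<in> E}"

text \<open>This lets a potential be multiplied by a constant on one component: both ends of every
  edge change by the same factor.\<close>

lemma component_closed:
  assumes "{a, b} \<in> E"
  shows "(q, a) \<in> (adjacency E)\<^sup>* \<longleftrightarrow> (q, b) \<in> (adjacency E)\<^sup>*"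
proof -
  have "(a, b) \<in> adjacency E" "(b, a) \<in> adjacency E"
    using assms by (auto simp: insert_commute)
  then show ?thesis by (meson rtrancl.rtrancl_into_rtrancl)
qed

text \<open>A path is extended step by step; if the new vertex already lies on it, the path is cut
  off there instead.\<close>

lemma rtrancl_imp_distinct_path:
  assumes "(x, y) \<in> (adjacency E)\<^sup>*"
  shows "\<exists>vs. vs \<noteq> [] \<and> distinct vs \<and> hd vs = x \<and> last vs = y \<and>
    successively (\<lambda>a b. {a, b} \<in> E) vs"
  using assms
proof (induction rule: rtrancl_induct)
  case base
  show ?case by (rule exI[of _ "[x]"]) simp
next
  case (step y z)
  then obtain vs where vs: "vs \<noteq> []" "distinct vs" "hd vs = x" "last vs = y"
    "successively (\<lambda>a b. {a, b} \<in> E) vs" by blast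
  show ?case
  proof (cases "z \<in> set vs")
    case True
    then obtain as bs where "vs = as @ z # bs" by (meson split_list)
    then have "vs = (as @ [z]) @ bs" by simp
    then have "distinct (as @ [z])" "hd (as @ [z]) = x"
      "successively (\<lambda>a b. {a, b} \<in> E) (as @ [z])"
      using vs by (auto simp: successively_append_iff hd_append split: if_splits)
    then show ?thesis by (intro exI[of _ "as @ [z]"]) auto
  next
    case False
    then show ?thesis
      using vs step.hyps(2)
      by (intro exI[of _ "vs @ [z]"]) (auto simp: successively_append_iff)
  qed
qed

text \<open>The new edge closes a path between its ends. Read contrapositively: if adding an absent
  edge creates no cycle, its ends lie in different components.\<close>

lemma insert_edge_cycle:
  assumes "(x, y) \<in> (adjacency E)\<^sup>*" and "x \<noteq> y" and "{x, y} \<notin> E"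
  shows "\<exists>C. cycle_in (insert {x, y} E) C \<and> {x, y} \<in> C"
proof -
  obtain vs where vs: "vs \<noteq> []" "distinct vs" "hd vs = x" "last vs = y"
    "successively (\<lambda>a b. {a, b} \<in> E) vs"
    using rtrancl_imp_distinct_path[OF assms(1)] by blast
  have path: "{vs ! k, vs ! Suc k} \<in> E" if "Suc k < length vs" for k
    using vs(5) that by (simp add: successively_conv_nth)
  define n where "n = length vs"
  have ends: "vs ! 0 = x" "vs ! (n - 1) = y"
    using vs by (simp_all add: n_def hd_conv_nth last_conv_nth)
  have "n \<noteq> 0" "n \<noteq> 1" using vs assms(2) ends by (auto simp: n_def)
  \<comment> \<open>A path with two vertices would be the absent edge itself.\<close>
  moreover have "n \<noteq> 2" using path[of 0] ends assms(3) by (auto simp: n_def)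
  ultimately have n: "n \<ge> 3" by linarith
  define C where "C = {{vs ! k, vs ! (Suc k mod n)} | k. k < n}"
  \<comment> \<open>The last index wraps around to \<open>0\<close>, so this pair is the closing
    edge.\<close>
  have wrap: "{vs ! (n - 1), vs ! (Suc (n - 1) mod n)} = {x, y}"
    using n ends by auto
  have "{vs ! k, vs ! (Suc k mod n)} \<in> insert {x, y} E" if "k < n" for k
  proof (cases "Suc k = n")
    case True
    then have "k = n - 1" by simp
    then show ?thesis using wrap by simp
  next
    case False
    with that have "Suc k < n" by simp
    then show ?thesis using path[of k] by (simp add: n_def)
  qed
  then have "C \<subseteq> insert {x, y} E" by (auto simp: C_def)
  moreover have "{x, y} \<in> C"
    unfolding C_def using wrap[symmetric] n by (intro CollectI exI[of _ "n - 1"] conjI) simp_all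
  moreover have "cycle_graph n C"
    unfolding cycle_graph_def C_def using n vs(2) n_def by blast
  ultimately show ?thesis unfolding cycle_in_def by blast
qed

lemma cycle_in_mono: "cycle_in E C \<Longrightarrow> E \<subseteq> F \<Longrightarrow> cycle_in F C"
  by (auto simp: cycle_in_def)

lemma cycle_graph_consecutive_edges:
  assumes "cycle_graph n C"
  obtains p q r where "distinct [p, q, r]" "{p, q} \<in> C" "{q, r} \<in> C"
proof -
  obtain vs where n: "n \<ge> 3" and vs: "distinct vs" "length vs = n"
    and C: "C = {{vs ! k, vs ! (Suc k mod n)} | k. k < n}"
    using assms unfolding cycle_graph_def by blast
  have "{vs ! 0, vs ! 1} \<in> C" unfolding C using n by (intro CollectI exI[of _ 0]) simp
  moreover have "{vs ! 1, vs ! 2} \<in> C"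
    unfolding C using n by (intro CollectI exI[of _ 1]) (simp add: numeral_2_eq_2)
  moreover have "distinct [vs ! 0, vs ! 1, vs ! 2]"
    using n vs by (simp add: nth_eq_iff_index_eq)
  ultimately show ?thesis using that by blast
qed

text \<open>Induction on the edges: the ends of a new edge lie in different components, so a
  rescaling on one of them fits the new edge and keeps the old ones. That \<open>g x y\<close> and
  \<open>g y x\<close> are inverse settles both directions of the new edge at once.\<close>

lemma forest_potential:
  fixes g :: "'v \<Rightarrow> 'v \<Rightarrow> complex"
  assumes "finite F"
    and "\<And>e. e \<in> F \<Longrightarrow> card e = 2"
    and "\<And>x y. {x, y} \<in> F \<Longrightarrow> g x y \<in> quarter_turns \<and> g x y * g y x = 1"
    and "\<nexists>C. cycle_in F C"
  shows "\<exists>d. range d \<subseteq> quarter_turns \<and> (\<forall>x y. {x, y} \<in> F \<longrightarrow> d x * g x y = d y)"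
  using assms
proof (induction F rule: finite_induct)
  case empty
  show ?case by (rule exI[of _ "\<lambda>_. 1"]) auto
next
  case (insert e F)
  have "\<nexists>C. cycle_in F C" using insert.prems(3) cycle_in_mono by blast
  then obtain d where d: "range d \<subseteq> quarter_turns" "\<And>x y. {x, y} \<in> F \<Longrightarrow> d x * g x y = d y"
    using insert by auto
  obtain x y where e: "e = {x, y}" "x \<noteq> y"
    using insert.prems(1)[of e] by (auto simp: card_2_iff)
  have apart: "(y, x) \<notin> (adjacency F)\<^sup>*"
    using insert_edge_cycle[of y x F] insert.hyps(2) insert.prems(3) e
    by (auto simp: insert_commute)
  have g: "g x y \<in> quarter_turns" "g x y * g y x = 1"
    using insert.prems(2)[of x y] e by auto
  \<comment> \<open>The factor on the component of \<open>y\<close> that the equation for the step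
    from \<open>x\<close> to \<open>y\<close> forces.\<close>
  define c where "c = d x * g x y / d y"
  have c: "c \<in> quarter_turns" and cy: "c * d y = d x * g x y"
    using d(1) g(1) quarter_turns_nonzero[of "d y"]
    by (auto simp: c_def intro!: quarter_turns_divide quarter_turns_mult)
  define d' where "d' z = (if (y, z) \<in> (adjacency F)\<^sup>* then c * d z else d z)" for z
  have xy: "d' x = d x" "d' y = d x * g x y" using apart cy by (auto simp: d'_def)
  have "d' a * g a b = d' b" if "{a, b} \<in> insert e F" for a b
  proof (cases "{a, b} \<in> F")
    case True
    show ?thesis
      using component_closed[OF True, of y] d(2)[OF True] by (simp add: d'_def mult.assoc)
  next
    case False
    then have "a = x \<and> b = y \<or> a = y \<and> b = x" using that e by (auto simp: doubleton_eq_iff)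
    then show ?thesis using xy g(2) by auto
  qed
  moreover have "range d' \<subseteq> quarter_turns"
    using d(1) c by (auto simp: d'_def intro!: quarter_turns_mult)
  ultimately show ?case by blast
qed

section \<open>Entries of the Hermitian adjacency matrix and switching\<close>

lemma underlying_card: "mixed_graph X \<Longrightarrow> e \<in> underlying X \<Longrightarrow> card e = 2"
  by (auto simp: mixed_graph_def underlying_def)

text \<open>Opposite entries are conjugate and of modulus one, hence inverse to each other. The
  disjointness conditions in \<open>mixed_graph\<close> make the case distinctions for
  \<open>(j, k)\<close> and \<open>(k, j)\<close> agree.\<close>

lemma hermitian_adj_edge:
  assumes "mixed_graph X" "{j, k} \<in> underlying X"
  shows "hermitian_adj X $ j $ k \<in> quarter_turns"
    and "hermitian_adj X $ j $ k * hermitian_adj X $ k $ j = 1"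
proof -
  have "{j, k} \<in> undirected X \<or> (j, k) \<in> directed X \<or> (k, j) \<in> directed X"
    using assms(2) by (auto simp: underlying_def doubleton_eq_iff)
  moreover have "(j, k) \<in> directed X \<Longrightarrow> (k, j) \<notin> directed X \<and> {j, k} \<notin> undirected X"
    using assms(1) by (simp add: mixed_graph_def)
  moreover have "(k, j) \<in> directed X \<Longrightarrow> {j, k} \<notin> undirected X"
    using assms(1) unfolding mixed_graph_def by (metis insert_commute)
  ultimately show "hermitian_adj X $ j $ k \<in> quarter_turns"
    "hermitian_adj X $ j $ k * hermitian_adj X $ k $ j = 1"
    by (auto simp: hermitian_adj_def quarter_turns_def insert_commute[of k j])
qed

lemma hermitian_adj_nonedge:
  "{j, k} \<notin> underlying X \<Longrightarrow> hermitian_adj X $ j $ k = 0"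
  by (auto simp: hermitian_adj_def underlying_def insert_commute)

lemma hermitian_adj_undirected:
  "{j, k} \<in> undirected X \<Longrightarrow> hermitian_adj X $ j $ k = 1"
  by (simp add: hermitian_adj_def)

lemma hermitian_adj_directed:
  assumes "mixed_graph X" "(j, k) \<in> directed X"
  shows "hermitian_adj X $ j $ k = \<i>" and "hermitian_adj X $ k $ j = - \<i>"
  using assms by (auto simp: mixed_graph_def hermitian_adj_def insert_commute)

text \<open>Multiplying the switching identity by the diagonal matrix on the left clears its
  inverse; what remains is compared entry by entry.\<close>

lemma switching_equivalentI:
  assumes d: "range d \<subseteq> quarter_turns"
    and comm: "\<And>j k. d j * hermitian_adj X $ j $ k = hermitian_adj Y $ j $ k * d k"
  shows "switching_equivalent X Y"
proof -
  define D :: "complex ^ 'a ^ 'a" where "D = (\<chi> j k. if j = k then d j else 0)"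
  define D' :: "complex ^ 'a ^ 'a" where "D' = (\<chi> j k. if j = k then inverse (d j) else 0)"
  have nz: "d j \<noteq> 0" for j using d quarter_turns_nonzero by blast
  have D_left: "(D ** M) $ j $ k = d j * M $ j $ k" for M :: "complex ^ 'a ^ 'a" and j k
  proof -
    \<comment> \<open>With the conditional outermost, the sum over \<open>l\<close> collapses to one
      term.\<close>
    have "(if j = l then d j else 0) * M $ l $ k = (if j = l then d j * M $ l $ k else 0)" for l
      by simp
    then show ?thesis by (simp only: D_def matrix_matrix_mult_def vec_lambda_beta) simp
  qed
  have D_right: "(M ** D) $ j $ k = M $ j $ k * d k" for M :: "complex ^ 'a ^ 'a" and j k
  proof -
    have "M $ j $ l * (if l = k then d l else 0) = (if l = k then M $ j $ l * d l else 0)" for l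
      by simp
    then show ?thesis by (simp only: D_def matrix_matrix_mult_def vec_lambda_beta) simp
  qed
  have "D ** D' = mat 1" "D' ** D = mat 1"
    using nz by (auto simp: vec_eq_iff D_left D_right D'_def mat_def)
  then have "invertible D" by (auto simp: invertible_def)
  \<comment> \<open>\<open>matrix_inv\<close> chooses some two-sided inverse, so the existence of
    one suffices.\<close>
  then have inv: "matrix_inv D ** D = mat 1"
    unfolding invertible_def matrix_inv_def by (rule someI2_ex) simp
  have "D ** hermitian_adj X = hermitian_adj Y ** D"
    using comm by (simp add: vec_eq_iff D_left D_right)
  then have "matrix_inv D ** hermitian_adj Y ** D = hermitian_adj X"
    using inv by (metis matrix_mul_assoc matrix_mul_lid)
  then show ?thesis
    unfolding switching_equivalent_def using d
    by (intro exI[of _ D]) (auto simp: D_def quarter_turns_def image_subset_iff)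
qed

section \<open>Mixed graphs with a prescribed set of directed edges\<close>

definition orient :: "'v set set \<Rightarrow> ('v \<times> 'v) set \<Rightarrow> 'v mixed_graph" where
  "orient E A = \<lparr>undirected = E - {{x, y} | x y. (x, y) \<in> A}, directed = A\<rparr>"

lemma underlying_orient: "(\<And>x y. (x, y) \<in> A \<Longrightarrow> {x, y} \<in> E) \<Longrightarrow> underlying (orient E A) = E"
  by (auto simp: underlying_def orient_def)

lemma mixed_graph_orient:
  assumes "\<And>e. e \<in> E \<Longrightarrow> card e = 2" "\<And>x y. (x, y) \<in> A \<Longrightarrow> x \<noteq> y \<and> (y, x) \<notin> A"
  shows "mixed_graph (orient E A)"
  using assms by (auto simp: mixed_graph_def orient_def)

section \<open>The cycle of a unicyclic graph and the distribution of its gain\<close>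

lemma unicyclic_same_underlying:
  "unicyclic X \<Longrightarrow> mixed_graph Y \<Longrightarrow> underlying Y = underlying X \<Longrightarrow> unicyclic Y"
  by (simp add: unicyclic_def)

lemma cycle_edges_same_underlying:
  "underlying Y = underlying X \<Longrightarrow> cycle_edges Y = cycle_edges X"
  by (simp add: cycle_edges_def)

lemma unicyclic_cycle_edges:
  assumes "unicyclic X"
  shows "cycle_in (underlying X) (cycle_edges X)"
    and "cycle_in (underlying X) C \<Longrightarrow> C = cycle_edges X"
  using assms unfolding unicyclic_def cycle_edges_def by (metis theI')+

lemma underlying_cycle_of:
  assumes "unicyclic X"
  shows "underlying (cycle_of X) = cycle_edges X"
  using unicyclic_cycle_edges(1)[OF assms]
  by (auto simp: cycle_in_def underlying_def cycle_of_def)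

lemma mixed_cycle_cycle_of_iff:
  assumes "unicyclic X"
  shows "mixed_cycle n (cycle_of X) \<longleftrightarrow> cycle_graph n (cycle_edges X)"
  using assms underlying_cycle_of[OF assms]
  by (auto simp: mixed_cycle_def unicyclic_def mixed_graph_def cycle_of_def)

text \<open>A potential of the forest without \<open>{p, q}\<close> and \<open>{q, r}\<close> makes
  its edges undirected, and \<open>w\<close> is then the gain left on the two deleted steps.
  Rescaling on the component of \<open>q\<close> shifts gain between these steps and preserves their
  product, so one \<open>w\<close> serves for every \<open>Y\<close>.\<close>

lemma switching_distribution:
  assumes X: "unicyclic X"
    and pqr: "distinct [p, q, r]" "{p, q} \<in> cycle_edges X" "{q, r} \<in> cycle_edges X"
  obtains w where "w \<in> quarter_turns"
    and "\<And>Y. mixed_graph Y \<Longrightarrow> underlying Y = underlying X \<Longrightarrow>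
      underlying X - {{p, q}, {q, r}} \<subseteq> undirected Y \<Longrightarrow>
      hermitian_adj Y $ p $ q * hermitian_adj Y $ q $ r = w \<Longrightarrow> switching_equivalent X Y"
proof -
  let ?E = "underlying X" and ?H = "\<lambda>j k. hermitian_adj X $ j $ k"
  define G where "G = ?E - {{p, q}, {q, r}}"
  have mg: "mixed_graph X" using X by (simp add: unicyclic_def)
  have sub: "cycle_edges X \<subseteq> ?E" using unicyclic_cycle_edges(1)[OF X] by (simp add: cycle_in_def)
  have neq: "{p, q} \<noteq> {q, r}" using pqr(1) by (auto simp: doubleton_eq_iff)
  \<comment> \<open>A cycle of a subgraph is the unique cycle of \<open>X\<close>, so no subgraph
    lacking one of the two edges contains a cycle.\<close>
  have through: "{p, q} \<in> C \<and> {q, r} \<in> C" if "cycle_in F C" "F \<subseteq> ?E" for F C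
    using unicyclic_cycle_edges(2)[OF X] cycle_in_mono[OF that] pqr by blast
  have "\<nexists>C. cycle_in G C"
    using through[of G] by (auto simp: G_def cycle_in_def)
  then obtain d where d: "range d \<subseteq> quarter_turns" "\<And>x y. {x, y} \<in> G \<Longrightarrow> d x * ?H x y = d y"
    using forest_potential[of G ?H] hermitian_adj_edge[OF mg] underlying_card[OF mg]
    by (auto simp: G_def)
  \<comment> \<open>Such a path together with \<open>{q, p}\<close> would form a cycle that avoids
    \<open>{q, r}\<close>.\<close>
  have "(q, p) \<notin> (adjacency G)\<^sup>*"
  proof
    assume "(q, p) \<in> (adjacency G)\<^sup>*"
    then obtain C where C: "cycle_in (insert {q, p} G) C"
      using insert_edge_cycle[of q p G] pqr(1) by (auto simp: G_def insert_commute)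
    moreover have "insert {q, p} G \<subseteq> ?E" using sub pqr by (auto simp: G_def insert_commute)
    ultimately have "{q, r} \<in> insert {q, p} G" using through unfolding cycle_in_def by blast
    then show False using neq by (auto simp: G_def insert_commute)
  qed
  moreover have "(q, r) \<notin> (adjacency G)\<^sup>*"
  proof
    assume "(q, r) \<in> (adjacency G)\<^sup>*"
    then obtain C where C: "cycle_in (insert {q, r} G) C"
      using insert_edge_cycle[of q r G] pqr(1) by (auto simp: G_def)
    moreover have "insert {q, r} G \<subseteq> ?E" using sub pqr by (auto simp: G_def)
    ultimately have "{p, q} \<in> insert {q, r} G" using through unfolding cycle_in_def by blast
    then show False using neq by (auto simp: G_def)
  qed
  ultimately have apart: "(q, p) \<notin> (adjacency G)\<^sup>*" "(q, r) \<notin> (adjacency G)\<^sup>*" .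
  have edges: "{p, q} \<in> ?E" "{q, r} \<in> ?E" using sub pqr by auto
  have d_in: "d z \<in> quarter_turns" and d_nz: "d z \<noteq> 0" for z
    using d(1) quarter_turns_nonzero by auto
  \<comment> \<open>The product of the two gains after switching by \<open>d\<close>; the value
    \<open>d q\<close> cancels.\<close>
  define w where "w = d p * ?H p q * ?H q r / d r"
  show thesis
  proof
    show "w \<in> quarter_turns"
      unfolding w_def using d_in hermitian_adj_edge(1)[OF mg] edges
      by (intro quarter_turns_divide quarter_turns_mult) auto
  next
    fix Y
    assume Y: "mixed_graph Y" "underlying Y = ?E" "?E - {{p, q}, {q, r}} \<subseteq> undirected Y"
      and prod: "hermitian_adj Y $ p $ q * hermitian_adj Y $ q $ r = w"
    let ?K = "\<lambda>j k. hermitian_adj Y $ j $ k"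
    have K: "?K p q \<in> quarter_turns" "?K q r \<in> quarter_turns"
      using hermitian_adj_edge(1)[OF Y(1)] Y(2) edges by auto
    \<comment> \<open>Solves the switching equation at \<open>(p, q)\<close>, where \<open>p\<close>
      keeps the value \<open>d p\<close> and \<open>q\<close> gets \<open>t * d q\<close>.\<close>
    define t where "t = d p * ?H p q / (d q * ?K p q)"
    have t: "t \<in> quarter_turns"
      unfolding t_def using d_in K hermitian_adj_edge(1)[OF mg] edges
      by (intro quarter_turns_divide quarter_turns_mult) auto
    define s where "s z = (if (q, z) \<in> (adjacency G)\<^sup>* then t * d z else d z)" for z
    have s: "s p = d p" "s q = t * d q" "s r = d r" using apart by (auto simp: s_def)
    have pq: "s p * ?H p q = ?K p q * s q"
      using s d_nz quarter_turns_nonzero[OF K(1)] by (simp add: t_def)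
    \<comment> \<open>With \<open>t\<close> already fixed, the equation at \<open>(q, r)\<close>
      holds exactly because the gains of \<open>Y\<close> multiply to \<open>w\<close>; the common
      factor \<open>?K p q\<close> cancels at the end.\<close>
    have "?K p q * (s q * ?H q r) = d p * ?H p q * ?H q r"
      using pq s(1) by (simp add: mult.assoc[symmetric])
    also have "\<dots> = w * d r" using d_nz by (simp add: w_def)
    also have "\<dots> = ?K p q * (?K q r * s r)" using prod s(3) by (simp add: mult.assoc[symmetric])
    finally have qr: "s q * ?H q r = ?K q r * s r" using quarter_turns_nonzero[OF K(1)] by simp
    \<comment> \<open>Reversing a step inverts both gains, so one direction of each edge
      suffices.\<close>
    have flip: "s k * ?H k j = ?K k j * s j"
      if "{j, k} \<in> ?E" "s j * ?H j k = ?K j k * s k" for j k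
    proof -
      have "?H j k * ?H k j = 1" "?K j k * ?K k j = 1"
        using hermitian_adj_edge(2)[OF mg] hermitian_adj_edge(2)[OF Y(1)] Y(2) that(1) by auto
      then show ?thesis using that(2) by algebra
    qed
    show "switching_equivalent X Y"
    proof (rule switching_equivalentI)
      show "range s \<subseteq> quarter_turns" using d_in t by (auto simp: s_def intro!: quarter_turns_mult)
      fix j k
      consider "{j, k} \<notin> ?E" | "{j, k} \<in> G" | "{j, k} = {p, q}" | "{j, k} = {q, r}"
        by (auto simp: G_def)
      then show "s j * ?H j k = ?K j k * s k"
      proof cases
        case 1
        then show ?thesis using Y(2) by (simp add: hermitian_adj_nonedge)
      next
        case 2
        then have "?K j k = 1" using Y(3) by (auto simp: G_def hermitian_adj_undirected)
        then show ?thesis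
          using component_closed[OF 2, of q] d(2)[OF 2] by (simp add: s_def mult.assoc)
      next
        case 3
        then show ?thesis using pq flip edges by (auto simp: doubleton_eq_iff)
      next
        case 4
        then show ?thesis using qr flip edges by (auto simp: doubleton_eq_iff)
      qed
    qed
  qed
qed

section \<open>Realizing the four possible values of the cycle gain\<close>

theorem theorem2p5:
  fixes X :: "'v::finite mixed_graph" and n :: nat
  assumes "unicyclic X"
    and "mixed_cycle n (cycle_of X)"
  shows "\<exists>Y. unicyclic Y \<and> underlying Y = underlying X \<and> switching_equivalent X Y \<and>
    (underlying Y = undirected Y \<or>
     is_C1 n (cycle_of Y) \<and> underlying Y - cycle_edges Y \<subseteq> undirected Y \<or>
     is_C2 n (cycle_of Y) \<and> underlying Y - cycle_edges Y \<subseteq> undirected Y)"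
proof -
  let ?E = "underlying X" and ?C = "cycle_edges X"
  have mg: "mixed_graph X" using assms(1) by (simp add: unicyclic_def)
  have sub: "?C \<subseteq> ?E" using unicyclic_cycle_edges(1)[OF assms(1)] by (simp add: cycle_in_def)
  have cyc: "cycle_graph n ?C" using assms by (simp add: mixed_cycle_cycle_of_iff)
  then obtain p q r where pqr: "distinct [p, q, r]" "{p, q} \<in> ?C" "{q, r} \<in> ?C"
    by (rule cycle_graph_consecutive_edges)
  have edges: "{p, q} \<in> ?E" "{q, r} \<in> ?E" using sub pqr by auto
  obtain w where w: "w \<in> quarter_turns"
    and switch: "\<And>Y. mixed_graph Y \<Longrightarrow> underlying Y = ?E \<Longrightarrow>
      ?E - {{p, q}, {q, r}} \<subseteq> undirected Y \<Longrightarrow>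
      hermitian_adj Y $ p $ q * hermitian_adj Y $ q $ r = w \<Longrightarrow> switching_equivalent X Y"
    using switching_distribution[OF assms(1) pqr] by metis
  \<comment> \<open>The candidates direct only the two chosen edges. Both directions of
    \<open>{q, r}\<close> are offered, since the gains \<open>\<i>\<close> and \<open>- \<i>\<close>
    call for opposite ones, but never together.\<close>
  define good where "good A \<longleftrightarrow> A \<subseteq> {(p, q), (q, r), (r, q)} \<and> \<not> {(q, r), (r, q)} \<subseteq> A \<and>
    hermitian_adj (orient ?E A) $ p $ q * hermitian_adj (orient ?E A) $ q $ r = w" for A
  have mixed: "mixed_graph (orient ?E A)"
    if "A \<subseteq> {(p, q), (q, r), (r, q)}" "\<not> {(q, r), (r, q)} \<subseteq> A" for A
    using that underlying_card[OF mg] pqr(1) by (intro mixed_graph_orient) auto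
  have goodD: "unicyclic (orient ?E A)" "underlying (orient ?E A) = ?E"
    "switching_equivalent X (orient ?E A)" "?E - cycle_edges (orient ?E A) \<subseteq> undirected (orient ?E A)"
    "mixed_cycle n (cycle_of (orient ?E A))" "directed (cycle_of (orient ?E A)) = A"
    if "good A" for A
  proof -
    let ?Y = "orient ?E A"
    have A: "A \<subseteq> {(p, q), (q, r), (r, q)}" and mY: "mixed_graph ?Y"
      using that mixed by (auto simp: good_def)
    have A_C: "{x, y} \<in> ?C" if "(x, y) \<in> A" for x y
      using that A pqr by (auto simp: insert_commute)
    show uY: "underlying ?Y = ?E" using A_C sub by (intro underlying_orient) auto
    then have cY: "cycle_edges ?Y = ?C" by (rule cycle_edges_same_underlying)
    show uni: "unicyclic ?Y" using assms(1) mY uY by (rule unicyclic_same_underlying)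
    have "?E - {{p, q}, {q, r}} \<subseteq> undirected ?Y"
      using A by (auto simp: orient_def insert_commute)
    then show "switching_equivalent X ?Y"
      using switch mY uY that by (simp add: good_def)
    show "?E - cycle_edges ?Y \<subseteq> undirected ?Y" using A_C cY by (auto simp: orient_def)
    show "mixed_cycle n (cycle_of ?Y)" using cyc cY uni by (simp add: mixed_cycle_cycle_of_iff)
    show "directed (cycle_of ?Y) = A" using A_C cY by (auto simp: cycle_of_def orient_def)
  qed
  have und: "undirected (orient ?E A) = ?E - {{x, y} | x y. (x, y) \<in> A}" for A
    by (simp add: orient_def)
  have dir: "directed (orient ?E A) = A" for A by (simp add: orient_def)
  have fwd: "hermitian_adj (orient ?E A) $ x $ y = \<i>"
    and bwd: "hermitian_adj (orient ?E A) $ y $ x = - \<i>"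
    if "A \<subseteq> {(p, q), (q, r), (r, q)}" "\<not> {(q, r), (r, q)} \<subseteq> A" "(x, y) \<in> A" for A x y
    using hermitian_adj_directed[OF mixed[OF that(1,2)]] that(3) dir by auto
  have plain: "hermitian_adj (orient ?E A) $ x $ y = 1"
    if "{x, y} \<in> ?E" "(x, y) \<notin> A" "(y, x) \<notin> A" for A x y
    using that by (intro hermitian_adj_undirected) (auto simp: und doubleton_eq_iff)
  \<comment> \<open>The values factor over the steps \<open>(p, q)\<close> and \<open>(q, r)\<close>
    as \<open>1 * 1\<close>, \<open>1 * \<i>\<close>, \<open>1 * (- \<i>)\<close> and
    \<open>\<i> * \<i>\<close>. The middle two both give \<open>is_C1\<close>, with opposite
    directions; the last gives two consecutive edges directed alike.\<close>
  consider "w = 1" | "w = \<i>" | "w = - \<i>" | "w = - 1" using w by (auto simp: quarter_turns_def)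
  then show ?thesis
  proof cases
    case 1
    then have "good {}" using edges by (simp add: good_def plain)
    moreover have "undirected (orient ?E {}) = ?E" by (simp add: und)
    ultimately show ?thesis using goodD[of "{}"] by metis
  next
    case 2
    then have "good {(q, r)}" using edges pqr(1) by (simp add: good_def plain fwd)
    then show ?thesis using goodD[of "{(q, r)}"] unfolding is_C1_def by metis
  next
    case 3
    then have "good {(r, q)}" using edges pqr(1) by (simp add: good_def plain bwd)
    then show ?thesis using goodD[of "{(r, q)}"] unfolding is_C1_def by metis
  next
    case 4
    then have "good {(p, q), (q, r)}" using pqr(1) by (auto simp: good_def fwd)
    then show ?thesis using goodD[of "{(p, q), (q, r)}"] pqr(1) unfolding is_C2_def by metis
  qed
qed

end
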